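(* Let $n\ge2$, $n'=\frac n{n-1}$, and let $\Omega\subset\mathbb{R}^n$ be a bounded open set with $|\Omega|=1$. For $t\in(0,1)$ and nonnegative $f\in L^{n',\infty}(\Omega)$ put $$K_0(f;t)=t\,\sup\left\{\left(\int_E f_*^{n'}(\sigma)\,d\sigma\right)^{\frac1{n'}}:\ E\subset(0,1)\text{ measurable},\ \int_E\frac{dx}{x}=t^{-n'}\right\}.$$ Then the $K$-functional of the couple $(L^{n',\infty},L^{n'})$ is given, up to equivalence, by $K_0$: there are constants $c_1,c_2>0$, independent of $f$ and $t$, with $$c_1K_0(f;t)\le K(f,t;L^{n',\infty},L^{n'})\le c_2K_0(f;t)\qquad\text{for all } t\in(0,1)\text{ and all }0\le f\in L^{n',\infty}(\Omega).$$
   Context: For measurable $f:\Omega\to\mathbb{R}$, $f_*$ is the decreasing rearrangement of $|f|$ on $(0,1)$: $f_*(s)=\inf\{t\ge0:|\{x:|f(x)|>t\}|\le s\}$, and $f_*^{n'}=(f_* )^{n'}$. $\|f\|_{L^{p,\infty}}=\sup_{0<s<1}s^{1/p}f_*(s)$. For a compatible couple $(X_0,X_1)$, $K(f,t;X_0,X_1)=\inf_{f=f_0+f_1}(\|f_0\|_{X_0}+t\|f_1\|_{X_1})$. *)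

theory Defs
  imports "HOL-Analysis.Analysis"
begin

text \<open>Real powers on \<^typ>\<open>ennreal\<close>, for positive exponents.\<close>

definition ennreal_powr :: "ennreal \<Rightarrow> real \<Rightarrow> ennreal" where
  "ennreal_powr x a = (if x = \<infinity> then \<infinity> else ennreal (enn2real x powr a))"

text \<open>For measurable f on a finite measure space and s > 0 the set below is nonempty, since the
  measure of the superlevel sets tends to 0; so the real infimum is the genuine one.\<close>

definition decreasing_rearrangement :: "'a measure \<Rightarrow> ('a \<Rightarrow> real) \<Rightarrow> real \<Rightarrow> real" where
  "decreasing_rearrangement M f s =
     Inf {t. 0 \<le> t \<and> emeasure M {x \<in> space M. \<bar>f x\<bar> > t} \<le> ennreal s}"

definition Lp_norm :: "'a measure \<Rightarrow> real \<Rightarrow> ('a \<Rightarrow> real) \<Rightarrow> ennreal" where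
  "Lp_norm M p f = ennreal_powr (\<integral>\<^sup>+x. ennreal (\<bar>f x\<bar> powr p) \<partial>M) (1 / p)"

text \<open>The supremum runs over 0 < s < 1 only: the underlying space has total measure 1.\<close>

definition weak_Lp_norm :: "'a measure \<Rightarrow> real \<Rightarrow> ('a \<Rightarrow> real) \<Rightarrow> ennreal" where
  "weak_Lp_norm M p f =
     (SUP s\<in>{0<..<1}. ennreal (s powr (1 / p) * decreasing_rearrangement M f s))"

text \<open>Function spaces are given by an extended-valued (quasi-)norm; the space consists of the
  measurable functions on which it is finite. Functions equal almost everywhere are not
  quotiented out; instead the decompositions in the K-functional are required to hold
  almost everywhere.\<close>

definition fun_space :: "'a measure \<Rightarrow> (('a \<Rightarrow> real) \<Rightarrow> ennreal) \<Rightarrow> ('a \<Rightarrow> real) set" where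
  "fun_space M N = {f \<in> borel_measurable M. N f < \<infinity>}"

definition K_functional ::
  "'a measure \<Rightarrow> (('a \<Rightarrow> real) \<Rightarrow> ennreal) \<Rightarrow> (('a \<Rightarrow> real) \<Rightarrow> ennreal) \<Rightarrow> ('a \<Rightarrow> real) \<Rightarrow> real \<Rightarrow> ennreal"
  where
  "K_functional M N0 N1 f t =
     (INF (f0, f1) \<in> {(f0, f1). f0 \<in> fun_space M N0 \<and> f1 \<in> fun_space M N1 \<and>
                                (AE x in M. f x = f0 x + f1 x)}.
        N0 f0 + ennreal t * N1 f1)"

definition K0 :: "'a measure \<Rightarrow> real \<Rightarrow> ('a \<Rightarrow> real) \<Rightarrow> real \<Rightarrow> ennreal" where
  "K0 M p f t =
     ennreal t *
     (SUP E \<in> {E. E \<in> sets lebesgue \<and> E \<subseteq> {0<..<1} \<and>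
                  (\<integral>\<^sup>+x\<in>E. ennreal (1 / x) \<partial>lebesgue) = ennreal (t powr (- p))}.
        ennreal_powr
          (\<integral>\<^sup>+\<sigma>\<in>E. ennreal (decreasing_rearrangement M f \<sigma> powr p) \<partial>lebesgue) (1 / p))"

definition conj_exponent :: "nat \<Rightarrow> real" where
  "conj_exponent n = real n / (real n - 1)"

end

theory Submission
  imports Defs "HOL-Probability.Distribution_Functions"
begin

text \<open>Write \<open>g = f\<^sub>*\<close> and \<open>h(s) = s\<^sup>1\<^sup>/\<^sup>p g(s)\<close>. With respect to the measure \<open>\<nu> = ds/s\<close> on \<open>(0,1)\<close>, the weak norm of \<open>f\<close>
  is the sup norm of \<open>h\<close> and the \<open>L\<^sup>p\<close> norm of \<open>f\<close> is the \<open>L\<^sup>p(\<nu>)\<close> norm of \<open>h\<close>. The claim is thus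
  modelled on the classical formula for the \<open>K\<close>-functional of the couple \<open>(L\<^sup>\<infinity>, L\<^sup>p)\<close> over \<open>\<nu>\<close>, evaluated at
  \<open>h\<close>: the quantity \<open>K\<^sub>0\<close> collects the \<open>p\<close>-th power mass of \<open>h\<close> on a set of \<open>\<nu>\<close>-measure
  \<open>\<lambda> = t\<^sup>-\<^sup>p\<close>. Norms and \<open>K\<^sub>0\<close> depend on distribution functions alone, so the natural
  setting is a probability space and an exponent \<open>p \<ge> 1\<close>; the constants are \<open>1/4\<close> and \<open>4\<close>.

  Lower bound (\<open>K0_le_decomposition\<close>). If \<open>f = f\<^sub>0 + f\<^sub>1\<close>, then \<open>g(s)\<close> is at most the sum of the two
  rearrangements at \<open>s/2\<close>. Over a set \<open>E\<close> with \<open>\<nu>(E) = \<lambda>\<close> the first contributes at most a constant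
  times the \<open>p\<close>-th power of the weak norm of \<open>f\<^sub>0\<close> times \<open>\<lambda>\<close>, the second a constant times the
  \<open>p\<close>-th power of the \<open>L\<^sup>p\<close> norm of \<open>f\<^sub>1\<close>.

  Upper bound (\<open>K_functional_le\<close>). Let \<open>A > K\<^sub>0(f;t)\<close> and \<open>F = {h > A}\<close>. A set \<open>E\<close> of \<open>\<nu>\<close>-measure
  \<open>\<lambda>\<close> can be chosen comparable to \<open>F\<close> by inclusion, because \<open>\<nu>\<close> has no atoms and infinite mass
  (\<open>ex_log_measure_comparable\<close>). It cannot lie inside \<open>F\<close>, since then \<open>K\<^sub>0(f;t) \<ge> A\<close>; hence it contains \<open>F\<close>,
  and \<open>t\<close> times the \<open>L\<^sup>p\<close> norm of \<open>g\<close> over \<open>F\<close> is at most \<open>A\<close> (\<open>nn_integral_superlevel_le_K0\<close>).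
  The decomposition should put into \<open>f\<^sub>1\<close> the part of \<open>f\<close> whose rank lies in \<open>F\<close>.
  Ranks are not defined where \<open>f\<close> takes a value on a set of positive measure, so \<open>f\<close> is cut
  according to its values instead: \<open>f\<^sub>1\<close> keeps the values \<open>c\<close> with \<open>c\<^sup>p |{g \<ge> c}| > 2 A\<^sup>p\<close>. On a plateau
  of \<open>g\<close> this may take more than \<open>F\<close> does, but a dyadic dilation argument
  (\<open>nn_integral_heavy_levels_le\<close>) shows that the integral of \<open>g\<^sup>p\<close> at most doubles.\<close>

section \<open>Powers\<close>

lemma ennreal_powr_inverse_le_iff:
  assumes "0 < p" "0 \<le> b"
  shows "ennreal_powr I (1 / p) \<le> ennreal b \<longleftrightarrow> I \<le> ennreal (b powr p)"
proof (cases I)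
  case (real r)
  have "r powr (1 / p) \<le> b \<longleftrightarrow> r \<le> b powr p"
  proof
    assume "r powr (1 / p) \<le> b"
    then have "(r powr (1 / p)) powr p \<le> b powr p"
      using assms by (intro powr_mono2) auto
    then show "r \<le> b powr p" using assms real by (simp add: powr_powr)
  next
    assume "r \<le> b powr p"
    then have "r powr (1 / p) \<le> (b powr p) powr (1 / p)"
      using assms real by (intro powr_mono2) auto
    then show "r powr (1 / p) \<le> b" using assms by (simp add: powr_powr)
  qed
  then show ?thesis using real assms by (simp add: ennreal_powr_def ennreal_le_iff)
qed (auto simp: ennreal_powr_def top_unique)

lemma powr_add_superadditive:
  fixes x y p :: real
  assumes "0 \<le> x" "0 \<le> y" "1 \<le> p"
  shows "x powr p + y powr p \<le> (x + y) powr p"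
proof -
  have split: "z powr p = z * z powr (p - 1)" if "0 \<le> z" for z :: real
    using that by (cases "z = 0") (auto simp: powr_diff)
  have "x * x powr (p - 1) + y * y powr (p - 1)
      \<le> x * (x + y) powr (p - 1) + y * (x + y) powr (p - 1)"
    using assms by (intro add_mono mult_left_mono powr_mono2) auto
  then show ?thesis using assms by (simp add: split[of x] split[of y] split[of "x+y"] distrib_right)
qed

section \<open>The decreasing rearrangement\<close>

text \<open>The Galois connection between the rearrangement and the distribution function, from which
  all further properties of the rearrangement follow. It rests on two continuity properties of
  the distribution function: it tends to 0 at infinity, so that the defining infimum is over a nonempty set,
  and it is continuous from the right, so that the inequality stays strict at the infimum.\<close>

lemma (in prob_space) less_decreasing_rearrangement_iff:
  assumes f [measurable]: "f \<in> borel_measurable M" and s: "0 < s" and t: "0 \<le> t"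
  shows "t < decreasing_rearrangement M f s
     \<longleftrightarrow> ennreal s < emeasure M {x \<in> space M. t < \<bar>f x\<bar>}"
proof -
  define m where "m u = emeasure M {x \<in> space M. u < \<bar>f x\<bar>}" for u
  define S where "S = {u. 0 \<le> u \<and> m u \<le> ennreal s}"
  have g: "decreasing_rearrangement M f s = Inf S"
    by (simp add: decreasing_rearrangement_def S_def m_def)
  have m_mono: "m v \<le> m u" if "u \<le> v" for u v
    unfolding m_def using that by (intro emeasure_mono) auto
  have "(\<lambda>k. m (real k)) \<longlonglongrightarrow> emeasure M (\<Inter>k. {x \<in> space M. real k < \<bar>f x\<bar>})"
    unfolding m_def by (intro Lim_emeasure_decseq) (auto simp: decseq_def)
  moreover have "(\<Inter>k. {x \<in> space M. real k < \<bar>f x\<bar>}) = {}"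
      proof safe
    fix x assume *: "x \<in> (\<Inter>k. {x \<in> space M. real k < \<bar>f x\<bar>})"
    obtain k where "\<bar>f x\<bar> < real k" using reals_Archimedean2 by blast
    moreover have "real k < \<bar>f x\<bar>" using * by auto
    ultimately show "x \<in> {}" by simp
  qed
  ultimately have "(\<lambda>k. m (real k)) \<longlonglongrightarrow> 0" by simp
  then have "\<forall>\<^sub>F k in sequentially. m (real k) < ennreal s"
    using s by (intro order_tendstoD(2)) auto
  then obtain k where "m (real k) < ennreal s"
    by (auto simp: eventually_sequentially)
  then have nonempty: "S \<noteq> {}" by (auto simp: S_def intro!: exI[of _ "real k"])
  have bdd: "bdd_below S" by (auto simp: S_def intro!: bdd_belowI[of _ 0])
  have "t < Inf S \<longleftrightarrow> ennreal s < m t"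
  proof
    assume "t < Inf S"
    then have "t \<notin> S" using cInf_lower[OF _ bdd, of t] by auto
    then show "ennreal s < m t" using t by (auto simp: S_def)
  next
    assume *: "ennreal s < m t"
    have "(\<lambda>k. m (t + 1 / real (Suc k)))
        \<longlonglongrightarrow> emeasure M (\<Union>k. {x \<in> space M. t + 1 / real (Suc k) < \<bar>f x\<bar>})"
      unfolding m_def
    proof (intro Lim_emeasure_incseq)
      have "t + 1 / real (Suc n) \<le> t + 1 / real (Suc m)" if "m \<le> n" for m n
        using that by (intro add_left_mono divide_left_mono) auto
      then show "incseq (\<lambda>k. {x \<in> space M. t + 1 / real (Suc k) < \<bar>f x\<bar>})"
        unfolding incseq_def by (blast intro: order_le_less_trans)
    qed auto
    moreover have "(\<Union>k. {x \<in> space M. t + 1 / real (Suc k) < \<bar>f x\<bar>}) = {x \<in> space M. t < \<bar>f x\<bar>}"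
    proof safe
      fix x assume "x \<in> space M" "t < \<bar>f x\<bar>"
      then obtain k where "inverse (real (Suc k)) < \<bar>f x\<bar> - t"
        using reals_Archimedean[of "\<bar>f x\<bar> - t"] by auto
      then show "x \<in> (\<Union>k. {x \<in> space M. t + 1 / real (Suc k) < \<bar>f x\<bar>})"
        using \<open>x \<in> space M\<close> by (auto simp: inverse_eq_divide intro!: exI[of _ k])
    next
      fix x k assume "t + 1 / real (Suc k) < \<bar>f x\<bar>"
      moreover have "0 < 1 / real (Suc k)" by simp
      ultimately show "t < \<bar>f x\<bar>" by linarith
    qed
    ultimately have "(\<lambda>k. m (t + 1 / real (Suc k))) \<longlonglongrightarrow> m t" by (simp add: m_def)
    then have "\<forall>\<^sub>F k in sequentially. ennreal s < m (t + 1 / real (Suc k))"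
      using * by (rule order_tendstoD(1))
    then obtain k where k: "ennreal s < m (t + 1 / real (Suc k))"
      by (auto simp: eventually_sequentially)
    have "t + 1 / real (Suc k) \<le> Inf S"
    proof (rule cInf_greatest[OF nonempty])
      fix u assume "u \<in> S"
      then have "m u \<le> ennreal s" by (simp add: S_def)
      then show "t + 1 / real (Suc k) \<le> u"
        using k m_mono[of u "t + 1 / real (Suc k)"] by (meson leD le_cases order_le_less_trans)
    qed
    moreover have "0 < 1 / real (Suc k)" by simp
    ultimately show "t < Inf S" by linarith
  qed
  then show ?thesis by (simp add: g m_def)
qed

lemma (in prob_space) decreasing_rearrangement_nonneg:
  assumes f [measurable]: "f \<in> borel_measurable M" and s: "0 < s"
  shows "0 \<le> decreasing_rearrangement M f s"
proof (rule ccontr)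
  assume neg: "\<not> 0 \<le> decreasing_rearrangement M f s"
  define S where "S = {u. 0 \<le> u \<and> emeasure M {x \<in> space M. u < \<bar>f x\<bar>} \<le> ennreal s}"
  have g: "decreasing_rearrangement M f s = Inf S"
    by (simp add: decreasing_rearrangement_def S_def)
  have "S \<noteq> {}"
  proof -
    have "\<not> (\<bar>Inf S\<bar> < decreasing_rearrangement M f s)" unfolding g by linarith
    then show ?thesis 
      using less_decreasing_rearrangement_iff[OF f s, of "\<bar>Inf S\<bar>"] by (auto simp: S_def not_less intro!: exI[of _ "\<bar>Inf S\<bar>"])
  qed
  then have "0 \<le> Inf S" by (rule cInf_greatest) (auto simp: S_def)
  then show False using neg g by simp
qed

lemma (in prob_space) decreasing_rearrangement_antimono:
  assumes f [measurable]: "f \<in> borel_measurable M" and s: "0 < s" "s \<le> r"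
  shows "decreasing_rearrangement M f r \<le> decreasing_rearrangement M f s"
proof (rule ccontr)
  assume "\<not> ?thesis"
  then have "ennreal r < emeasure M {x \<in> space M. decreasing_rearrangement M f s < \<bar>f x\<bar>}"
    using less_decreasing_rearrangement_iff[OF f, of r "decreasing_rearrangement M f s"]
      decreasing_rearrangement_nonneg[OF f] s by auto
  moreover have "\<not> ennreal s < emeasure M {x \<in> space M. decreasing_rearrangement M f s < \<bar>f x\<bar>}"
    using less_decreasing_rearrangement_iff[OF f, of s "decreasing_rearrangement M f s"]
      decreasing_rearrangement_nonneg[OF f] s by auto
  moreover have "ennreal s \<le> ennreal r" using s by (simp add: ennreal_leI)
  ultimately show False by auto
qed

lemma (in prob_space) decreasing_rearrangement_measurable [measurable]:
  assumes f [measurable]: "f \<in> borel_measurable M"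
  shows "decreasing_rearrangement M f \<in> borel_measurable borel"
proof -
  let ?g = "decreasing_rearrangement M f"
  have "mono_on {0<..} (\<lambda>s. - ?g s)"
    using decreasing_rearrangement_antimono[OF f] by (auto simp: mono_on_def)
  then have "(\<lambda>s. - ?g s) \<in> borel_measurable (restrict_space borel {0<..})"
    by (rule borel_measurable_mono_on_fnc)
  then have "(\<lambda>s. if s \<in> {0<..} then - ?g s else - ?g 0) \<in> borel_measurable borel"
    by (subst (asm) measurable_restrict_space_iff[where c = "- ?g 0"]) auto
  then have "(\<lambda>s. - (if s \<in> {0<..} then - ?g s else - ?g 0)) \<in> borel_measurable borel"
    by (rule borel_measurable_uminus)
  also have "(\<lambda>s. - (if s \<in> {0<..} then - ?g s else - ?g 0)) = ?g"
    by (auto simp: fun_eq_iff decreasing_rearrangement_def ennreal_neg)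
  finally show ?thesis .
qed

text \<open>By the Galois connection the superlevel set \<open>{g > t}\<close> in \<open>(0,1)\<close> is the interval
  \<open>(0, |{|f| > t}|)\<close>; superlevel sets determine a finite Borel measure.\<close>

lemma (in prob_space) distr_decreasing_rearrangement:
  assumes f [measurable]: "f \<in> borel_measurable M"
  shows "distr (restrict_space lborel {0<..<1}) borel (decreasing_rearrangement M f)
       = distr M borel (\<lambda>x. \<bar>f x\<bar>)"
proof (rule measure_eqI_lessThan)
  let ?g = "decreasing_rearrangement M f"
  have [measurable]: "?g \<in> borel_measurable (restrict_space lborel {0<..<1})"
    by (intro measurable_restrict_space1) simp
  fix t :: real
  have m1: "emeasure M {x \<in> space M. t < \<bar>f x\<bar>} \<le> 1" by (rule measure_le_1)
  have "emeasure lborel ({0<..<1} \<inter> {s. t < ?g s}) = emeasure M {x \<in> space M. t < \<bar>f x\<bar>}"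
  proof (cases "0 \<le> t")
    case True
    define a where "a = measure M {x \<in> space M. t < \<bar>f x\<bar>}"
    have a: "emeasure M {x \<in> space M. t < \<bar>f x\<bar>} = ennreal a" "0 \<le> a" "a \<le> 1"
      by (auto simp: a_def emeasure_eq_measure)
    have "{0<..<1} \<inter> {s. t < ?g s} = {0<..<a}"
      using a less_decreasing_rearrangement_iff[OF f _ True] by (auto simp: ennreal_less_iff)
    then show ?thesis using a by simp
  next
    case False
    then have "{x \<in> space M. t < \<bar>f x\<bar>} = space M" by auto
    moreover have "{0<..<1} \<inter> {s. t < ?g s} = {0<..<1}"
      using False decreasing_rearrangement_nonneg[OF f]
      by (auto simp: not_le intro: order_less_le_trans)
    ultimately show ?thesis by (simp add: emeasure_space_1)
  qed
  moreover have "?g -` {t<..} \<inter> {0<..<1} = {0<..<1} \<inter> {s. t < ?g s}" by auto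
  ultimately have eq: "emeasure (distr (restrict_space lborel {0<..<1}) borel ?g) {t<..}
      = emeasure M {x \<in> space M. t < \<bar>f x\<bar>}"
    by (simp add: emeasure_distr emeasure_restrict_space space_restrict_space)
  have vf: "(\<lambda>x. \<bar>f x\<bar>) -` {t<..} \<inter> space M = {x \<in> space M. t < \<bar>f x\<bar>}" by auto
  show "emeasure (distr (restrict_space lborel {0<..<1}) borel ?g) {t<..}
      = emeasure (distr M borel (\<lambda>x. \<bar>f x\<bar>)) {t<..}"
    unfolding eq by (simp add: emeasure_distr vf)
  show "emeasure (distr (restrict_space lborel {0<..<1}) borel ?g) {t<..} < \<infinity>"
    unfolding eq using m1 by (simp add: le_less_trans)
qed auto

lemma (in prob_space) nn_integral_decreasing_rearrangement:
  assumes f [measurable]: "f \<in> borel_measurable M" and [measurable]: "\<psi> \<in> borel_measurable borel"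
  shows "(\<integral>\<^sup>+s\<in>{0<..<1}. \<psi> (decreasing_rearrangement M f s) \<partial>lborel) = (\<integral>\<^sup>+x. \<psi> \<bar>f x\<bar> \<partial>M)"
proof -
  have [measurable]: "decreasing_rearrangement M f \<in> borel_measurable (restrict_space lborel {0<..<1})"
    by (intro measurable_restrict_space1) simp
  have "(\<integral>\<^sup>+s\<in>{0<..<1}. \<psi> (decreasing_rearrangement M f s) \<partial>lborel)
      = (\<integral>\<^sup>+s. \<psi> (decreasing_rearrangement M f s) \<partial>restrict_space lborel {0<..<1})"
    by (simp add: nn_integral_restrict_space)
  also have "\<dots> = (\<integral>\<^sup>+y. \<psi> y \<partial>distr (restrict_space lborel {0<..<1}) borel (decreasing_rearrangement M f))"
    by (simp add: nn_integral_distr)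
  also have "\<dots> = (\<integral>\<^sup>+x. \<psi> \<bar>f x\<bar> \<partial>M)"
    unfolding distr_decreasing_rearrangement[OF f] by (simp add: nn_integral_distr)
  finally show ?thesis .
qed

text \<open>Where \<open>f\<^sub>0 + f\<^sub>1\<close> exceeds \<open>u + v\<close>, one summand exceeds its share; halving \<open>s\<close> gives each summand
  an exceptional set of measure at most \<open>s/2\<close>.\<close>

lemma (in prob_space) decreasing_rearrangement_add_le:
  assumes f [measurable]: "f \<in> borel_measurable M" 
    and f0 [measurable]: "f0 \<in> borel_measurable M" and f1 [measurable]: "f1 \<in> borel_measurable M"
    and eq: "AE x in M. f x = f0 x + f1 x" and s: "0 < s"
  shows "decreasing_rearrangement M f s
      \<le> decreasing_rearrangement M f0 (s / 2) + decreasing_rearrangement M f1 (s / 2)"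
proof -
  define u v where "u = decreasing_rearrangement M f0 (s / 2)"
    and "v = decreasing_rearrangement M f1 (s / 2)"
  have uv: "0 \<le> u" "0 \<le> v"
    using s by (auto simp: u_def v_def intro!: decreasing_rearrangement_nonneg)
  have "emeasure M {x \<in> space M. u + v < \<bar>f x\<bar>}
      \<le> emeasure M ({x \<in> space M. u < \<bar>f0 x\<bar>} \<union> {x \<in> space M. v < \<bar>f1 x\<bar>})"
    using eq by (intro emeasure_mono_AE) auto
  also have "\<dots> \<le> emeasure M {x \<in> space M. u < \<bar>f0 x\<bar>} + emeasure M {x \<in> space M. v < \<bar>f1 x\<bar>}"
    by (intro emeasure_subadditive) auto
  also have "\<dots> \<le> ennreal (s / 2) + ennreal (s / 2)"
    using less_decreasing_rearrangement_iff[OF f0, of "s / 2" u] uv s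
      less_decreasing_rearrangement_iff[OF f1, of "s / 2" v]
    by (intro add_mono) (auto simp: u_def v_def)
  also have "\<dots> = ennreal s" using s by (simp flip: ennreal_plus)
  finally show ?thesis
    using less_decreasing_rearrangement_iff[OF f s, of "u + v"] uv
    by (auto simp: u_def v_def not_less[symmetric])
qed

section \<open>Sets of prescribed logarithmic measure\<close>

lemma nn_integral_reciprocal_unit_interval:
  "(\<integral>\<^sup>+x\<in>{0<..<1}. ennreal (1 / x) \<partial>lborel) = \<infinity>"
proof -
  have "ennreal L \<le> (\<integral>\<^sup>+x\<in>{0<..<1}. ennreal (1 / x) \<partial>lborel)" if L: "0 \<le> L" for L :: real
  proof -
    let ?I = "{exp (- (L + 1)) .. exp (- 1)}"
    have "(\<integral>\<^sup>+x\<in>?I. ennreal (1 / x) \<partial>lborel)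
        = ennreal (ln (exp (- 1)) - ln (exp (- (L + 1))))"
    proof (rule nn_integral_FTC_Icc)
      fix x assume "x \<in> ?I"
      then have "0 < x" by (auto intro: order_less_le_trans[OF exp_gt_zero])
      then show "DERIV ln x :> 1 / x" "0 \<le> 1 / x"
        by (auto intro!: derivative_eq_intros simp: inverse_eq_divide)
    qed (use L in auto)
    then have "ennreal L = (\<integral>\<^sup>+x\<in>?I. ennreal (1 / x) \<partial>lborel)" by simp
    also have "\<dots> \<le> (\<integral>\<^sup>+x\<in>{0<..<1}. ennreal (1 / x) \<partial>lborel)"
      by (intro nn_integral_mono)
         (auto simp: indicator_def intro: order_less_le_trans[OF exp_gt_zero] order_le_less_trans)
    finally show ?thesis .
  qed
  note bound = this
  show ?thesis
  proof (cases "\<integral>\<^sup>+x\<in>{0<..<1}. ennreal (1 / x) \<partial>lborel")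
    case (real r)
    then show ?thesis using bound[of "r + 1"] by (simp add: ennreal_le_iff)
  qed simp
qed

lemma (in finite_borel_measure) ex_atMost_measure_eq:
  assumes atomless: "\<And>x. measure M {x} = 0" and l: "0 < l" "l < measure M (space M)"
  obtains c where "measure M {..c} = l"
proof -
  have "\<forall>\<^sub>F x in at_bot. cdf M x < l"
    using cdf_lim_at_bot l(1) by (rule order_tendstoD(2))
  then obtain a where a: "cdf M a < l" by (auto simp: eventually_at_bot_linorder)
  have "\<forall>\<^sub>F x in at_top. l < cdf M x"
    using cdf_lim_at_top l(2) by (rule order_tendstoD(1))
  then obtain b where b: "l < cdf M b" by (auto simp: eventually_at_top_linorder)
  have "a \<le> b"
    using a b cdf_nondecreasing[of b a] by (cases "a \<le> b") auto
  moreover have "continuous_on {a..b} (cdf M)"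
    using atomless by (auto intro!: continuous_at_imp_continuous_on simp: isCont_cdf)
  ultimately obtain c where "cdf M c = l"
    using IVT'[of "cdf M" a l b] a b by auto
  then show ?thesis using that by (auto simp: cdf_def)
qed

text \<open>Away from 0 the measure \<open>dx/x\<close> is finite and has no atoms, so initial segments of a set realise
  every intermediate value; since \<open>l\<close> is finite, a part of \<open>G\<close> away from 0 suffices unless
  \<open>l\<close> is the measure of \<open>G\<close> itself.\<close>

lemma borel_subset_with_log_measure:
  assumes G [measurable]: "G \<in> sets borel" and G01: "G \<subseteq> {0<..<1}"
    and l: "0 \<le> l" "ennreal l \<le> (\<integral>\<^sup>+x\<in>G. ennreal (1 / x) \<partial>lborel)"
  obtains E where "E \<in> sets borel" "E \<subseteq> G" "(\<integral>\<^sup>+x\<in>E. ennreal (1 / x) \<partial>lborel) = ennreal l"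
proof -
  define D where "D = density lborel (\<lambda>x. ennreal (1 / x))"
  have D: "emeasure D X = (\<integral>\<^sup>+x\<in>X. ennreal (1 / x) \<partial>lborel)" if "X \<in> sets borel" for X
    using that by (simp add: D_def emeasure_density)
  have sets_D [simp, measurable_cong]: "sets D = sets borel" by (simp add: D_def)
  consider "l = 0" | "ennreal l = emeasure D G" | "0 < l" "ennreal l < emeasure D G"
    using l D[OF G] by fastforce
  then show ?thesis
  proof cases
    case 1
    then show ?thesis by (intro that[of "{}"]) auto
  next
    case 2
    then show ?thesis using D[OF G] by (intro that[of G]) auto
  next
    case 3
    define H where "H k = G \<inter> {1 / real (Suc k)<..}" for k
    have [measurable]: "H k \<in> sets borel" for k by (simp add: H_def)
    have "(\<lambda>k. emeasure D (H k)) \<longlonglongrightarrow> emeasure D (\<Union>k. H k)"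
    proof (intro Lim_emeasure_incseq)
      have "1 / real (Suc n) \<le> 1 / real (Suc m)" if "m \<le> n" for m n
        using that by (intro divide_left_mono) auto
      then show "incseq H"
        unfolding incseq_def H_def by (meson Int_mono greaterThan_subset_iff order_refl)
    qed auto
    moreover have "(\<Union>k. H k) = G"
    proof -
      have "\<exists>k. 1 / real (Suc k) < x" if "x \<in> G" for x
        using reals_Archimedean[of x] that G01 by (auto simp: inverse_eq_divide)
      then show ?thesis by (auto simp: H_def)
    qed
    ultimately have "(\<lambda>k. emeasure D (H k)) \<longlonglongrightarrow> emeasure D G" by simp
    then have "\<forall>\<^sub>F k in sequentially. ennreal l < emeasure D (H k)"
      using 3(2) by (rule order_tendstoD(1))
    then obtain k where k: "ennreal l < emeasure D (H k)"
      by (auto simp: eventually_sequentially)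
    define N where "N = density D (indicator (H k))"
    have sets_N [simp, measurable_cong]: "sets N = sets borel" by (simp add: N_def)
    have N: "emeasure N X = emeasure D (H k \<inter> X)" if [measurable]: "X \<in> sets borel" for X
      by (simp add: N_def emeasure_density indicator_inter_arith[symmetric])
    have [simp]: "space N = UNIV" by (simp add: N_def D_def)
    have "emeasure D (H k) \<le> (\<integral>\<^sup>+x. ennreal (real (Suc k)) * indicator {0<..<1::real} x \<partial>lborel)"
      unfolding D[OF \<open>H k \<in> sets borel\<close>]
    proof (rule nn_integral_mono)
      fix x show "ennreal (1 / x) * indicator (H k) x
          \<le> ennreal (real (Suc k)) * indicator {0<..<1} x"
      proof (cases "x \<in> H k")
        case True
        then have x: "x \<in> {0<..<1}" "1 / real (Suc k) < x" using G01 by (auto simp: H_def)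
        then have "1 / x \<le> real (Suc k)" by (simp add: field_simps)
        then show ?thesis using x True by (simp add: ennreal_leI del: of_nat_Suc)
      qed simp
    qed
    also have "\<dots> = ennreal (real (Suc k))" by (simp add: nn_integral_cmult_indicator del: of_nat_Suc)
    finally have fin: "emeasure D (H k) \<noteq> \<infinity>" by (auto simp: top_unique simp del: of_nat_Suc)
    interpret N: finite_borel_measure N
    proof (intro finite_borel_measure.intro finite_borel_measure_axioms.intro finite_measureI)
      have "emeasure N UNIV = emeasure D (H k)" using N[of UNIV] by simp
      then show "emeasure N (space N) \<noteq> \<infinity>" using fin by simp
    qed (rule sets_N)
    have "measure N {x} = 0" for x
    proof -
      have "emeasure N {x} \<le> emeasure D {x}" by (subst N) (auto intro: emeasure_mono)
      also have "\<dots> = (\<integral>\<^sup>+y. ennreal (1 / x) * indicator {x} y \<partial>lborel)"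
        by (subst D) (auto intro!: nn_integral_cong simp: indicator_def)
      also have "\<dots> = 0" by (simp add: nn_integral_cmult_indicator)
      finally show ?thesis by (simp add: measure_def)
    qed
    moreover have "l < measure N (space N)"
    proof -
      have "emeasure D (H k) = ennreal (measure N (space N))"
        using N[of UNIV] by (simp add: N.emeasure_eq_measure)
      then show ?thesis using k 3(1) by (simp add: ennreal_less_iff)
    qed
    ultimately obtain c where c: "measure N {..c} = l"
      using N.ex_atMost_measure_eq 3(1) by metis
    then have "emeasure D (H k \<inter> {..c}) = ennreal l"
      using N[of "{..c}"] by (simp add: N.emeasure_eq_measure)
    then show ?thesis
      using D[of "H k \<inter> {..c}"] by (intro that[of "H k \<inter> {..c}"]) (auto simp: H_def)
  qed
qed

text \<open>If \<open>F\<close> is too large, a subset of it is chosen; if it is too small, it is enlarged inside its complement,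
  which has infinite measure because \<open>(0,1)\<close> has.\<close>

lemma ex_log_measure_comparable:
  assumes F [measurable]: "F \<in> sets borel" and F01: "F \<subseteq> {0<..<1}" and l: "0 \<le> l"
  obtains E where "E \<in> sets borel" "E \<subseteq> {0<..<1}" "E \<subseteq> F \<or> F \<subseteq> E"
    "(\<integral>\<^sup>+x\<in>E. ennreal (1 / x) \<partial>lborel) = ennreal l"
proof -
  let ?\<nu> = "\<lambda>E. \<integral>\<^sup>+x\<in>E. ennreal (1 / x) \<partial>lborel"
  have add: "?\<nu> (A \<union> B) = ?\<nu> A + ?\<nu> B" if [measurable]: "A \<in> sets borel" "B \<in> sets borel"
    and "A \<inter> B = {}" for A B
    using that(3) by (subst nn_integral_add[symmetric])
      (auto intro!: nn_integral_cong simp: indicator_def)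
  show ?thesis
  proof (cases "ennreal l \<le> ?\<nu> F")
    case True
    obtain E where "E \<in> sets borel" "E \<subseteq> F" "?\<nu> E = ennreal l"
      using borel_subset_with_log_measure[OF F F01 l True] .
    then show ?thesis using that[of E] F01 by auto
  next
    case False
    then obtain r where r: "?\<nu> F = ennreal r" "0 \<le> r" "r \<le> l"
      using l by (cases "?\<nu> F") (auto simp: not_le ennreal_less_iff)
    define G where "G = {0<..<1} - F"
    have G [measurable]: "G \<in> sets borel" by (simp add: G_def)
    have "F \<union> G = {0<..<1}" "F \<inter> G = {}" using F01 by (auto simp: G_def)
    then have "?\<nu> F + ?\<nu> G = \<infinity>"
      using add[OF F G] nn_integral_reciprocal_unit_interval by simp
    then have "?\<nu> G = \<infinity>" using r by (simp add: ennreal_add_eq_top)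
    then obtain E where E: "E \<in> sets borel" "E \<subseteq> G" "?\<nu> E = ennreal (l - r)"
      using borel_subset_with_log_measure[OF G, of "l - r"] r by (auto simp: G_def)
    then have "?\<nu> (F \<union> E) = ennreal l"
      using add[OF F E(1)] r \<open>F \<inter> G = {}\<close> by (auto simp flip: ennreal_plus)
    then show ?thesis using that[of "F \<union> E"] E F01 by (auto simp: G_def)
  qed
qed

section \<open>Decompositions bound the supremum\<close>

lemma nn_integral_lborel_dilation:
  fixes u :: "real \<Rightarrow> ennreal"
  assumes [measurable]: "u \<in> borel_measurable borel" and c: "0 < c"
  shows "(\<integral>\<^sup>+x. u (c * x) \<partial>lborel) = ennreal (1 / c) * (\<integral>\<^sup>+x. u x \<partial>lborel)"
proof -
  have "ennreal (1 / c) * (\<integral>\<^sup>+x. u x \<partial>lborel)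
      = ennreal (1 / c) * ennreal c * (\<integral>\<^sup>+x. u (c * x) \<partial>lborel)"
    using nn_integral_real_affine[of u c 0] c by (simp add: mult.assoc)
  also have "ennreal (1 / c) * ennreal c = 1" using c by (simp flip: ennreal_mult)
  finally show ?thesis by simp
qed

lemma (in prob_space) Lp_norm_decreasing_rearrangement:
  assumes f [measurable]: "f \<in> borel_measurable M"
  shows "Lp_norm M p f = ennreal_powr
    (\<integral>\<^sup>+s\<in>{0<..<1}. ennreal (decreasing_rearrangement M f s powr p) \<partial>lborel) (1 / p)"
  unfolding Lp_norm_def
  by (subst nn_integral_decreasing_rearrangement[OF f, of "\<lambda>y. ennreal (y powr p)"]) auto

lemma (in prob_space) K0_le_decomposition:
  assumes p: "1 \<le> p" and t: "0 < t"
    and f [measurable]: "f \<in> borel_measurable M"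
    and f0: "f0 \<in> fun_space M (weak_Lp_norm M p)" and f1: "f1 \<in> fun_space M (Lp_norm M p)"
    and eq: "AE x in M. f x = f0 x + f1 x"
  shows "K0 M p f t \<le> 4 * (weak_Lp_norm M p f0 + ennreal t * Lp_norm M p f1)"
proof -
  let ?g = "decreasing_rearrangement M f"
  let ?gA = "decreasing_rearrangement M f0" and ?gB = "decreasing_rearrangement M f1"
  have [measurable]: "f0 \<in> borel_measurable M" "f1 \<in> borel_measurable M"
    using f0 f1 by (auto simp: fun_space_def)
  obtain a where a: "weak_Lp_norm M p f0 = ennreal a" "0 \<le> a"
    using f0 by (cases "weak_Lp_norm M p f0") (auto simp: fun_space_def)
  obtain b where b: "Lp_norm M p f1 = ennreal b" "0 \<le> b"
    using f1 by (cases "Lp_norm M p f1") (auto simp: fun_space_def)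
  have g0: "?gA s powr p \<le> a powr p / s" if s: "0 < s" "s < 1" for s
  proof -
    have "ennreal (s powr (1 / p) * ?gA s) \<le> ennreal a"
      unfolding a(1)[symmetric] weak_Lp_norm_def using s by (intro SUP_upper) auto
    then have "s powr (1 / p) * ?gA s \<le> a" using a by (simp add: ennreal_le_iff)
    then have "(s powr (1 / p) * ?gA s) powr p \<le> a powr p"
      using p s decreasing_rearrangement_nonneg[of f0 s] by (intro powr_mono2) auto
    then show ?thesis
      using p s decreasing_rearrangement_nonneg[of f0 s]
      by (simp add: powr_mult powr_powr field_simps)
  qed
  have g1: "(\<integral>\<^sup>+s\<in>{0<..<1}. ennreal (?gB s powr p) \<partial>lborel) \<le> ennreal (b powr p)"
  proof -
    have "ennreal_powr (\<integral>\<^sup>+s\<in>{0<..<1}. ennreal (?gB s powr p) \<partial>lborel) (1 / p) \<le> ennreal b"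
      by (subst Lp_norm_decreasing_rearrangement[symmetric]) (simp_all add: b(1))
    then show ?thesis using b(2) p by (subst (asm) ennreal_powr_inverse_le_iff) simp_all
  qed
  \<comment> \<open>Pointwise, \<open>(x + y)\<^sup>p \<le> 2\<^sup>p (x\<^sup>p + y\<^sup>p)\<close>; the extra factor 2 in the first term is \<open>1 / (s/2)\<close> against \<open>1 / s\<close>.\<close>
  have g: "?g s powr p \<le> 2 powr (p + 1) * a powr p * (1 / s) + 2 powr p * ?gB (s / 2) powr p"
    if s: "0 < s" "s < 1" for s
  proof -
    define m where "m = max (?gA (s / 2)) (?gB (s / 2))"
    have nonneg: "0 \<le> ?gA (s / 2)" "0 \<le> ?gB (s / 2)" "0 \<le> ?g s"
      using s by (auto intro!: decreasing_rearrangement_nonneg)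
    have "?g s \<le> 2 * m"
      using decreasing_rearrangement_add_le[OF f \<open>f0 \<in> borel_measurable M\<close> \<open>f1 \<in> borel_measurable M\<close> eq s(1)]
      by (simp add: m_def)
    then have "?g s powr p \<le> (2 * m) powr p" using nonneg p by (intro powr_mono2) auto
    also have "\<dots> = 2 powr p * m powr p" using nonneg by (simp add: m_def powr_mult)
    also have "m powr p \<le> ?gA (s / 2) powr p + ?gB (s / 2) powr p" by (simp add: m_def max_def)
    also have "?gA (s / 2) powr p \<le> a powr p / (s / 2)" using s by (intro g0) auto
    finally show ?thesis by (simp add: powr_add algebra_simps)
  qed
  have dil: "(\<integral>\<^sup>+s\<in>{0<..<1}. ennreal (?gB (s / 2) powr p) \<partial>lborel) \<le> 2 * ennreal (b powr p)"
  proof -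
    have "(\<integral>\<^sup>+s\<in>{0<..<1}. ennreal (?gB (s / 2) powr p) \<partial>lborel)
        \<le> (\<integral>\<^sup>+s. ennreal (?gB (1 / 2 * s) powr p) * indicator {0<..<1} (1 / 2 * s) \<partial>lborel)"
      by (intro nn_integral_mono) (auto simp: indicator_def)
    also have "\<dots> = ennreal (1 / (1 / 2)) * (\<integral>\<^sup>+s\<in>{0<..<1}. ennreal (?gB s powr p) \<partial>lborel)"
      by (rule nn_integral_lborel_dilation) auto
    also have "\<dots> \<le> 2 * ennreal (b powr p)" using g1 by (simp add: mult_left_mono)
    finally show ?thesis .
  qed
  have int: "(\<integral>\<^sup>+s\<in>E. ennreal (?g s powr p) \<partial>lebesgue) \<le> ennreal ((4 * (a + t * b) / t) powr p)"
    if E [measurable]: "E \<in> sets lebesgue" and E01: "E \<subseteq> {0<..<1}"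
      and \<nu>: "(\<integral>\<^sup>+x\<in>E. ennreal (1 / x) \<partial>lebesgue) = ennreal (t powr (- p))" for E
  proof -
    have [measurable]: "(\<lambda>s. ennreal (1 / s)) \<in> borel_measurable lebesgue"
      "(\<lambda>s. ennreal (?gB (s / 2) powr p) * indicator {0<..<1} s) \<in> borel_measurable lebesgue"
      by (intro measurable_completion; measurable)+
    have "(\<integral>\<^sup>+s\<in>E. ennreal (?g s powr p) \<partial>lebesgue)
        \<le> (\<integral>\<^sup>+s. ennreal (2 powr (p + 1) * a powr p) * (ennreal (1 / s) * indicator E s)
             + ennreal (2 powr p) * (ennreal (?gB (s / 2) powr p) * indicator {0<..<1} s) \<partial>lebesgue)"
      using E01 g by (intro nn_integral_mono)
        (auto simp: indicator_def ennreal_mult[symmetric] simp flip: ennreal_plus intro!: ennreal_leI)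
    also have "\<dots> = ennreal (2 powr (p + 1) * a powr p) * ennreal (t powr (- p))
        + ennreal (2 powr p) * (\<integral>\<^sup>+s\<in>{0<..<1}. ennreal (?gB (s / 2) powr p) \<partial>lebesgue)"
      by (subst nn_integral_add) (simp_all add: nn_integral_cmult \<nu> del: nn_integral_completion)
    also have "\<dots> \<le> ennreal (2 powr (p + 1) * a powr p) * ennreal (t powr (- p))
        + ennreal (2 powr p) * (ennreal 2 * ennreal (b powr p))"
      using dil by (intro add_mono mult_left_mono) (auto simp: nn_integral_completion)
    also have "\<dots> = ennreal (2 powr (p + 1) * (a powr p * t powr (- p) + b powr p))"
      by (simp add: powr_add algebra_simps del: ennreal_numeral flip: ennreal_mult ennreal_plus)
    also have "\<dots> \<le> ennreal (4 powr p * (a / t + b) powr p)"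
    proof (intro ennreal_leI mult_mono)
      have "(2::real) powr (p + 1) \<le> 2 powr (2 * p)" using p by (intro powr_mono) auto
      also have "\<dots> = 4 powr p" by (simp flip: powr_powr)
      finally show "(2::real) powr (p + 1) \<le> 4 powr p" .
      show "a powr p * t powr (- p) + b powr p \<le> (a / t + b) powr p"
        using powr_add_superadditive[of "a / t" b p] a b t p
        by (simp add: powr_divide powr_minus field_simps)
    qed auto
    also have "4 powr p * (a / t + b) powr p = (4 * (a + t * b) / t) powr p"
      using a b t by (simp flip: powr_mult add: field_simps)
    finally show ?thesis .
  qed
  have "K0 M p f t \<le> ennreal t * ennreal (4 * (a + t * b) / t)"
    unfolding K0_def using int a b t p
    by (intro mult_left_mono SUP_least) (auto simp: ennreal_powr_inverse_le_iff)
  also have "\<dots> = 4 * (ennreal a + ennreal t * ennreal b)"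
    using a b t by (simp flip: ennreal_mult ennreal_plus ennreal_numeral)
  finally show ?thesis by (simp add: a b)
qed

section \<open>Cutting a function by its values\<close>

text \<open>The values \<open>c\<close> of \<open>g\<close> for which \<open>s c\<^sup>p\<close>, taken at the right end \<open>s = |{g \<ge> c}|\<close> of the plateau at height
  \<open>c\<close>, exceeds \<open>2 a\<close>. The factor 2 ensures that \<open>s c\<^sup>p > a\<close> already holds from the middle of \<open>(0, |{g \<ge> c}|)\<close>
  onwards. Only positive values count, since real powers have their usual meaning only there.\<close>

definition heavy_levels :: "(real \<Rightarrow> real) \<Rightarrow> real \<Rightarrow> real \<Rightarrow> real set" where
  "heavy_levels g p a = {c. 0 < c \<and> 2 * a < c powr p * measure lborel {s \<in> {0<..<1}. c \<le> g s}}"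

lemma heavy_levels_measurable [measurable]:
  assumes [measurable]: "g \<in> borel_measurable borel"
  shows "heavy_levels g p a \<in> sets borel"
proof -
  define b where "b c = measure lborel {s \<in> {0<..<1}. c \<le> g s}" for c
  have "mono (\<lambda>c. - b c)"
  proof (rule monoI)
    fix c d :: real assume "c \<le> d"
    have "{s \<in> {0<..<1}. c \<le> g s} \<in> fmeasurable lborel"
      by (rule fmeasurableI2[of "{0<..<1}"]) (auto simp: fmeasurable_def)
    then show "- b c \<le> - b d"
      unfolding b_def using \<open>c \<le> d\<close> by (auto intro!: measure_mono_fmeasurable)
  qed
  then have "(\<lambda>c. - b c) \<in> borel_measurable borel" by (rule borel_measurable_mono)
  then have [measurable]: "b \<in> borel_measurable borel" by simp
  have "heavy_levels g p a = {c \<in> space borel. 0 < c \<and> 2 * a < c powr p * b c}"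
    by (simp add: heavy_levels_def b_def)
  then show ?thesis by simp
qed

lemma le_measure_superlevel:
  fixes g :: "real \<Rightarrow> real"
  assumes [measurable]: "g \<in> borel_measurable borel"
    and anti: "\<And>s r. 0 < s \<Longrightarrow> s \<le> r \<Longrightarrow> g r \<le> g s"
    and s: "s \<in> {0<..<1}"
  shows "s \<le> measure lborel {r \<in> {0<..<1}. g s \<le> g r}"
proof -
  have "{r \<in> {0<..<1}. g s \<le> g r} \<in> fmeasurable lborel"
    by (rule fmeasurableI2[of "{0<..<1}"]) (auto simp: fmeasurable_def)
  then have "measure lborel {0<..s} \<le> measure lborel {r \<in> {0<..<1}. g s \<le> g r}"
    using s anti by (intro measure_mono_fmeasurable) auto
  then show ?thesis using s by simp
qed

text \<open>Let \<open>F = {s. a < s g(s)\<^sup>p}\<close>. A point \<open>s\<close> with \<open>g(s)\<close> heavy need not lie in \<open>F\<close>, but some \<open>2\<^sup>k s\<close> does: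
  doubling until the upper half of \<open>(0, |{g \<ge> g(s)}|)\<close> is reached never lowers the value of \<open>g\<close>.
  Hence the integrand at \<open>s\<close> is bounded by the sum over all \<open>k\<close> of \<open>g\<^sup>p\<close> on \<open>F\<close> evaluated at \<open>2\<^sup>k s\<close>, and the
  dilations contribute the factors \<open>2\<^sup>-\<^sup>k\<close>, whose sum is 2.\<close>

lemma nn_integral_heavy_levels_le:
  fixes g :: "real \<Rightarrow> real"
  assumes g [measurable]: "g \<in> borel_measurable borel"
    and anti: "\<And>s r. 0 < s \<Longrightarrow> s \<le> r \<Longrightarrow> g r \<le> g s"
    and nonneg: "\<And>s. 0 < s \<Longrightarrow> 0 \<le> g s"
    and p: "0 < p" and a: "0 \<le> a"
  shows "(\<integral>\<^sup>+s\<in>{0<..<1}. indicator (heavy_levels g p a) (g s) * ennreal (g s powr p) \<partial>lborel)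
    \<le> 2 * (\<integral>\<^sup>+s\<in>{s \<in> {0<..<1}. a < s * g s powr p}. ennreal (g s powr p) \<partial>lborel)"
proof -
  define F where "F = {s \<in> {0<..<1}. a < s * g s powr p}"
  have [measurable]: "F \<in> sets borel" by (simp add: F_def)
  define u where "u s = ennreal (g s powr p) * indicator F s" for s
  have [measurable]: "u \<in> borel_measurable borel" unfolding u_def by measurable
  have ptw: "indicator (heavy_levels g p a) (g s) * ennreal (g s powr p) * indicator {0<..<1} s
      \<le> (\<Sum>k. u (2 ^ k * s))" for s
  proof (cases "s \<in> {0<..<1} \<and> g s \<in> heavy_levels g p a")
    case True
    then have s: "0 < s" "s < 1" and c: "0 < g s" by (auto simp: heavy_levels_def)
    define b where "b = measure lborel {r \<in> {0<..<1}. g s \<le> g r}"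
    have b: "2 * a < g s powr p * b" using True by (simp add: heavy_levels_def b_def)
    have le_b: "b \<le> y" if y: "0 < y" "g y < g s" for y
    proof -
      have "{r \<in> {0<..<1}. g s \<le> g r} \<subseteq> {0<..y}"
      proof
        fix r assume r: "r \<in> {r \<in> {0<..<1}. g s \<le> g r}"
        then have "\<not> y \<le> r" using anti[of y r] y by auto
        then show "r \<in> {0<..y}" using r by auto
      qed
      then have "measure lborel {r \<in> {0<..<1}. g s \<le> g r} \<le> measure lborel {0<..y}"
        using y by (intro measure_mono_fmeasurable) (auto simp: fmeasurable_def)
      then show ?thesis using y by (simp add: b_def)
    qed
    have "b \<le> measure lborel {0<..<1::real}"
      unfolding b_def by (intro measure_mono_fmeasurable) (auto simp: fmeasurable_def)
    then have b1: "b \<le> 1" by simp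
    have b0: "0 \<le> b" by (simp add: b_def)
    \<comment> \<open>The first dyadic multiple of \<open>s\<close> that is at least \<open>b / 2\<close>.\<close>
    define k where "k = (LEAST k. b \<le> 2 ^ Suc k * s)"
    obtain n where "b / s < 2 ^ n" using real_arch_pow[of 2 "b / s"] by auto
    then have "b < 2 ^ n * s" using s by (simp add: field_simps)
    moreover have "2 ^ n * s \<le> 2 ^ Suc n * s" using s by simp
    ultimately have "b \<le> 2 ^ Suc n * s" by linarith
    then have k: "b \<le> 2 ^ Suc k * s" unfolding k_def by (rule LeastI)
    define \<sigma> where "\<sigma> = 2 ^ k * s"
    have \<sigma>: "0 < \<sigma> \<and> \<sigma> < 1 \<and> g s \<le> g \<sigma>"
    proof (cases k)
      case 0
      then show ?thesis using s by (simp add: \<sigma>_def)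
    next
      case (Suc j)
      then have "j < k" by simp
      then have "\<not> b \<le> 2 ^ Suc j * s" unfolding k_def by (rule not_less_Least)
      then have "\<sigma> < b" using Suc by (simp add: \<sigma>_def)
      moreover have "0 < \<sigma>" using s by (simp add: \<sigma>_def)
      ultimately show ?thesis using le_b[of \<sigma>] b1 by force
    qed
    have "g s powr p * b \<le> g \<sigma> powr p * (2 * \<sigma>)"
      using \<sigma> k p c s b0 by (intro mult_mono powr_mono2) (auto simp: \<sigma>_def)
    then have "\<sigma> \<in> F" using b \<sigma> by (simp add: F_def algebra_simps)
    have "ennreal (g s powr p) \<le> u \<sigma>"
      using \<open>\<sigma> \<in> F\<close> \<sigma> p c by (auto simp: u_def intro!: ennreal_leI powr_mono2)
    also have "\<dots> = (\<Sum>i\<in>{k}. u (2 ^ i * s))" by (simp add: \<sigma>_def)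
    also have "\<dots> \<le> (\<Sum>k. u (2 ^ k * s))" by (intro sum_le_suminf) auto
    finally show ?thesis using True by simp
  qed auto
  have "(\<integral>\<^sup>+s\<in>{0<..<1}. indicator (heavy_levels g p a) (g s) * ennreal (g s powr p) \<partial>lborel)
      \<le> (\<integral>\<^sup>+s. (\<Sum>k. u (2 ^ k * s)) \<partial>lborel)"
    by (intro nn_integral_mono ptw)
  also have "\<dots> = (\<Sum>k. \<integral>\<^sup>+s. u (2 ^ k * s) \<partial>lborel)"
    by (intro nn_integral_suminf) measurable
  also have "\<dots> = (\<Sum>k. ennreal ((1 / 2) ^ k) * (\<integral>\<^sup>+s. u s \<partial>lborel))"
    by (simp add: nn_integral_lborel_dilation power_one_over)
  also have "\<dots> = (\<Sum>k. ennreal ((1 / 2) ^ k)) * (\<integral>\<^sup>+s. u s \<partial>lborel)"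
    by simp
  also have "(\<Sum>k. ennreal ((1 / 2) ^ k)) = ennreal 2"
    by (subst suminf_ennreal2) (auto simp: suminf_geometric)
  finally show ?thesis by (simp add: u_def F_def)
qed

section \<open>The supremum bounds the K-functional\<close>

text \<open>The set \<open>{A\<^sup>p < s g(s)\<^sup>p}\<close> is \<open>{h > A}\<close>. A set \<open>E\<close> admissible in \<open>K\<^sub>0\<close> cannot be contained in it, as the
  integral of \<open>g\<^sup>p\<close> over \<open>E\<close> would be at least \<open>A\<^sup>p t\<^sup>-\<^sup>p\<close>; so a comparable admissible set contains it.\<close>

lemma (in prob_space) nn_integral_superlevel_le_K0:
  assumes p: "0 < p" and t: "0 < t" and A: "0 < A"
    and f [measurable]: "f \<in> borel_measurable M" and K0: "K0 M p f t < ennreal A"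
  defines "g \<equiv> decreasing_rearrangement M f"
  shows "(\<integral>\<^sup>+s\<in>{s \<in> {0<..<1}. A powr p < s * g s powr p}. ennreal (g s powr p) \<partial>lborel)
      \<le> ennreal ((A / t) powr p)"
proof -
  define F where "F = {s \<in> {0<..<1}. A powr p < s * g s powr p}"
  have [measurable]: "g \<in> borel_measurable borel" unfolding g_def by simp
  have F: "F \<in> sets borel" "F \<subseteq> {0<..<1}" by (auto simp: F_def)
  obtain E where E: "E \<in> sets borel" "E \<subseteq> {0<..<1}" "E \<subseteq> F \<or> F \<subseteq> E"
    "(\<integral>\<^sup>+x\<in>E. ennreal (1 / x) \<partial>lborel) = ennreal (t powr (- p))"
    using ex_log_measure_comparable[OF F, of "t powr (- p)"] by auto
  let ?I = "\<integral>\<^sup>+s\<in>E. ennreal (g s powr p) \<partial>lborel"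
  have At: "(A / t) powr p = A powr p * t powr (- p)"
    using A t by (simp add: powr_divide powr_minus_divide)
  have "ennreal t * ennreal_powr ?I (1 / p) \<le> K0 M p f t"
    unfolding K0_def using E
    by (intro mult_left_mono SUP_upper2[of E]) (auto simp: nn_integral_completion g_def)
  then have tI: "ennreal t * ennreal_powr ?I (1 / p) < ennreal A" using K0 by (rule le_less_trans)
  have I: "?I < ennreal ((A / t) powr p)"
  proof (rule ccontr)
    assume "\<not> ?thesis"
    then have ge: "ennreal ((A / t) powr p) \<le> ?I" by simp
    have "ennreal (A / t) \<le> ennreal_powr ?I (1 / p)"
    proof (cases "ennreal_powr ?I (1 / p)")
      case (real r)
      then have "?I \<le> ennreal (r powr p)"
        using ennreal_powr_inverse_le_iff[of p r ?I] p by simp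
      then have "(A / t) powr p \<le> r powr p" using ge by (metis ennreal_le_iff order_trans powr_ge_zero)
      then have "A / t \<le> r" using p real powr_less_mono2[of p r "A / t"] by (auto simp: not_less[symmetric])
      then show ?thesis using real by (simp add: ennreal_leI)
    qed simp
    then have "ennreal t * ennreal (A / t) \<le> ennreal t * ennreal_powr ?I (1 / p)"
      by (rule mult_left_mono) simp
    then show False using tI t A by (simp flip: ennreal_mult)
  qed
  have "F \<subseteq> E"
  proof (rule ccontr)
    assume "\<not> F \<subseteq> E"
    then have "E \<subseteq> F" using E(3) by auto
    have "ennreal ((A / t) powr p) = (\<integral>\<^sup>+s. ennreal (A powr p) * (ennreal (1 / s) * indicator E s) \<partial>lborel)"
      using E(1,4) by (subst nn_integral_cmult) (auto simp: At ennreal_mult)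
    also have "\<dots> \<le> ?I"
    proof (rule nn_integral_mono)
      fix s
      show "ennreal (A powr p) * (ennreal (1 / s) * indicator E s) \<le> ennreal (g s powr p) * indicator E s"
      proof (cases "s \<in> E")
        case True
        then have "0 < s" "A powr p < s * g s powr p" using \<open>E \<subseteq> F\<close> by (auto simp: F_def)
        then have "A powr p * (1 / s) \<le> g s powr p" by (simp add: field_simps)
        then show ?thesis using True \<open>0 < s\<close> by (simp add: ennreal_leI flip: ennreal_mult)
      qed simp
    qed
    finally show False using I by simp
  qed
  then have "(\<integral>\<^sup>+s\<in>F. ennreal (g s powr p) \<partial>lborel) \<le> ?I"
    by (intro nn_integral_mono) (auto simp: indicator_def)
  then show ?thesis using I by (simp add: F_def)
qed

text \<open>The part \<open>f\<^sub>1\<close> of \<open>f\<close> with heavy values has \<open>L\<^sup>p\<close> norm at most \<open>2 A / t\<close> by the two preceding estimates.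
  For the remaining part, a rank \<open>r\<close> with \<open>g(r)\<close> not heavy satisfies \<open>r g(r)\<^sup>p \<le> 2 A\<^sup>p\<close>, because
  \<open>r \<le> |{g \<ge> g(r)}|\<close>; so the set where \<open>f\<^sub>0\<close> exceeds \<open>\<tau>\<close> has measure at most \<open>2 A\<^sup>p / \<tau>\<^sup>p\<close>.\<close>

lemma (in prob_space) K_functional_le:
  assumes p: "1 \<le> p" and t: "0 < t" and A: "0 < A"
    and f [measurable]: "f \<in> borel_measurable M" and K0: "K0 M p f t < ennreal A"
  shows "K_functional M (weak_Lp_norm M p) (Lp_norm M p) f t \<le> ennreal (4 * A)"
proof -
  define g where "g = decreasing_rearrangement M f"
  define C where "C = heavy_levels g p (A powr p)"
  define f1 where "f1 x = indicator C \<bar>f x\<bar> * f x" for x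
  define f0 where "f0 x = indicator (- C) \<bar>f x\<bar> * f x" for x
  have g [measurable]: "g \<in> borel_measurable borel" unfolding g_def by simp
  have anti: "g r \<le> g s" if "0 < s" "s \<le> r" for s r
    using that by (simp add: g_def decreasing_rearrangement_antimono)
  have nonneg: "0 \<le> g s" if "0 < s" for s
    using that by (simp add: g_def decreasing_rearrangement_nonneg)
  have C [measurable]: "C \<in> sets borel" by (simp add: C_def)
  have f1 [measurable]: "f1 \<in> borel_measurable M" unfolding f1_def by measurable
  have f0 [measurable]: "f0 \<in> borel_measurable M" unfolding f0_def by measurable
  have pow2: "2 \<le> (2::real) powr p" using p powr_mono[of 1 p "2::real"] by simp
  have N1: "Lp_norm M p f1 \<le> ennreal (2 * A / t)"
  proof -
    have "(\<integral>\<^sup>+x. ennreal (\<bar>f1 x\<bar> powr p) \<partial>M) = (\<integral>\<^sup>+x. indicator C \<bar>f x\<bar> * ennreal (\<bar>f x\<bar> powr p) \<partial>M)"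
      by (intro nn_integral_cong) (auto simp: f1_def indicator_def)
    also have "\<dots> = (\<integral>\<^sup>+s\<in>{0<..<1}. indicator C (g s) * ennreal (g s powr p) \<partial>lborel)"
      unfolding g_def
      by (subst nn_integral_decreasing_rearrangement[OF f, of "\<lambda>c. indicator C c * ennreal (c powr p)"]) auto
    also have "\<dots> \<le> 2 * (\<integral>\<^sup>+s\<in>{s \<in> {0<..<1}. A powr p < s * g s powr p}. ennreal (g s powr p) \<partial>lborel)"
      unfolding C_def using p by (intro nn_integral_heavy_levels_le g anti nonneg) auto
    also have "\<dots> \<le> 2 * ennreal ((A / t) powr p)"
      unfolding g_def using p t A f K0
      by (intro mult_left_mono nn_integral_superlevel_le_K0) auto
    also have "\<dots> \<le> ennreal (2 powr p) * ennreal ((A / t) powr p)"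
      using pow2 by (intro mult_right_mono) (auto intro: ennreal_leI simp flip: ennreal_numeral)
    also have "\<dots> = ennreal ((2 * A / t) powr p)"
      using A t by (simp flip: ennreal_mult powr_mult)
    finally show ?thesis
      unfolding Lp_norm_def using p A t by (subst ennreal_powr_inverse_le_iff) auto
  qed
  have N0: "weak_Lp_norm M p f0 \<le> ennreal (2 * A)"
    unfolding weak_Lp_norm_def
  proof (intro SUP_least ennreal_leI)
    fix s :: real assume "s \<in> {0<..<1}"
    then have s: "0 < s" "s < 1" by auto
    \<comment> \<open>It suffices that \<open>\<bar>f0\<bar>\<close> exceeds \<open>\<tau>\<close> on a set of measure at most \<open>s\<close>.\<close>
    define \<tau> where "\<tau> = 2 * A / s powr (1 / p)"
    have \<tau>: "0 < \<tau>" using A s by (simp add: \<tau>_def)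
    have \<tau>p: "\<tau> powr p = 2 powr p * A powr p / s"
      using A s p by (simp add: \<tau>_def powr_divide powr_mult powr_powr)
    have "2 * A powr p / \<tau> powr p \<le> s"
      using A s pow2 by (simp add: \<tau>p field_simps)
    have "emeasure M {x \<in> space M. \<tau> < \<bar>f0 x\<bar>}
        = (\<integral>\<^sup>+x. indicator {x \<in> space M. \<tau> < \<bar>f0 x\<bar>} x \<partial>M)"
      by (rule nn_integral_indicator[symmetric]) measurable
    also have "\<dots> = (\<integral>\<^sup>+x. indicator ({\<tau><..} - C) \<bar>f x\<bar> \<partial>M)"
      using \<tau> by (intro nn_integral_cong) (auto simp: f0_def indicator_def split: if_splits)
    also have "\<dots> = (\<integral>\<^sup>+r\<in>{0<..<1}. indicator ({\<tau><..} - C) (g r) \<partial>lborel)"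
      unfolding g_def
      by (subst nn_integral_decreasing_rearrangement[OF f, of "indicator ({\<tau><..} - C)"]) auto
    also have "\<dots> \<le> (\<integral>\<^sup>+r. indicator {0<..s} r \<partial>lborel)"
    proof (rule nn_integral_mono)
      fix r
      show "indicator ({\<tau><..} - C) (g r) * indicator {0<..<1} r \<le> (indicator {0<..s} r :: ennreal)"
      proof (cases "r \<in> {0<..<1} \<and> \<tau> < g r \<and> g r \<notin> C")
        case True
        have "g r powr p * r \<le> g r powr p * measure lborel {q \<in> {0<..<1}. g r \<le> g q}"
          using True le_measure_superlevel[OF g anti, of r] by (intro mult_left_mono) auto
        also have "\<dots> \<le> 2 * A powr p" using True \<tau> by (auto simp: C_def heavy_levels_def)
        finally have "g r powr p * r \<le> 2 * A powr p" .
        moreover have "\<tau> powr p * r \<le> g r powr p * r"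
          using True \<tau> p by (intro mult_right_mono powr_mono2) auto
        ultimately have "r \<le> 2 * A powr p / \<tau> powr p" using \<tau> by (simp add: field_simps)
        then have "r \<le> s" using \<open>2 * A powr p / \<tau> powr p \<le> s\<close> by linarith
        then show ?thesis using True by simp
      qed (auto simp: indicator_def)
    qed
    also have "\<dots> = ennreal s" using s by simp
    finally have "decreasing_rearrangement M f0 s \<le> \<tau>"
      using less_decreasing_rearrangement_iff[OF f0 s(1), of \<tau>] \<tau> by (auto simp: not_less[symmetric])
    then show "s powr (1 / p) * decreasing_rearrangement M f0 s \<le> 2 * A"
      using s by (simp add: \<tau>_def field_simps)
  qed
  have "(f0, f1) \<in> {(f0, f1). f0 \<in> fun_space M (weak_Lp_norm M p) \<and>
      f1 \<in> fun_space M (Lp_norm M p) \<and> (AE x in M. f x = f0 x + f1 x)}"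
  proof -
    have "f x = f0 x + f1 x" for x by (simp add: f0_def f1_def indicator_def)
    then show ?thesis
      using N0 N1 by (auto simp: fun_space_def intro: le_less_trans)
  qed
  then have "K_functional M (weak_Lp_norm M p) (Lp_norm M p) f t
      \<le> weak_Lp_norm M p f0 + ennreal t * Lp_norm M p f1"
    unfolding K_functional_def by (intro INF_lower2[of "(f0, f1)"]) auto
  also have "\<dots> \<le> ennreal (2 * A) + ennreal t * ennreal (2 * A / t)"
    using N0 N1 by (intro add_mono mult_left_mono) auto
  also have "\<dots> = ennreal (4 * A)" using A t by (simp flip: ennreal_mult ennreal_plus)
  finally show ?thesis .
qed

text \<open>The upper bound holds with every real \<open>A > K\<^sub>0(f;t)\<close> in place of \<open>K\<^sub>0(f;t)\<close>; letting \<open>A\<close> decrease gives the claim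
  when \<open>K\<^sub>0(f;t)\<close> is finite, and there is nothing to show otherwise.\<close>

lemma (in prob_space) K_functional_equiv_K0:
  assumes p: "1 \<le> p" and t: "0 < t" and f [measurable]: "f \<in> borel_measurable M"
  shows "ennreal (1 / 4) * K0 M p f t \<le> K_functional M (weak_Lp_norm M p) (Lp_norm M p) f t"
    and "K_functional M (weak_Lp_norm M p) (Lp_norm M p) f t \<le> ennreal 4 * K0 M p f t"
proof -
  have quarter: "ennreal (1 / 4) * (4 * x) = x" for x
    by (simp flip: mult.assoc ennreal_numeral ennreal_mult)
  show "ennreal (1 / 4) * K0 M p f t \<le> K_functional M (weak_Lp_norm M p) (Lp_norm M p) f t"
    unfolding K_functional_def
  proof (rule INF_greatest, clarify)
    fix f0 f1
    assume "f0 \<in> fun_space M (weak_Lp_norm M p)" "f1 \<in> fun_space M (Lp_norm M p)"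
      "AE x in M. f x = f0 x + f1 x"
    then have "K0 M p f t \<le> 4 * (weak_Lp_norm M p f0 + ennreal t * Lp_norm M p f1)"
      by (rule K0_le_decomposition[OF p t f])
    then have "ennreal (1 / 4) * K0 M p f t
        \<le> ennreal (1 / 4) * (4 * (weak_Lp_norm M p f0 + ennreal t * Lp_norm M p f1))"
      by (rule mult_left_mono) simp
    then show "ennreal (1 / 4) * K0 M p f t \<le> weak_Lp_norm M p f0 + ennreal t * Lp_norm M p f1"
      by (simp only: quarter)
  qed
  show "K_functional M (weak_Lp_norm M p) (Lp_norm M p) f t \<le> ennreal 4 * K0 M p f t"
  proof (cases "K0 M p f t")
    case (real r)
    show ?thesis
    proof (rule ennreal_le_epsilon)
      fix e :: real assume e: "0 < e"
      have "K_functional M (weak_Lp_norm M p) (Lp_norm M p) f t \<le> ennreal (4 * (r + e / 4))"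
        using real e by (intro K_functional_le p t f) (auto simp: ennreal_less_iff)
      also have "\<dots> = ennreal 4 * K0 M p f t + ennreal e"
        using real e by (simp add: distrib_left flip: ennreal_mult ennreal_plus ennreal_numeral)
      finally show "K_functional M (weak_Lp_norm M p) (Lp_norm M p) f t
          \<le> ennreal 4 * K0 M p f t + ennreal e" .
    qed
  qed (simp add: ennreal_mult_top)
qed

theorem theorem1p9:
  fixes \<Omega> :: "(real ^ 'n) set"
  defines "M \<equiv> lebesgue_on \<Omega>"
    and "p \<equiv> conj_exponent CARD('n)"
  assumes "CARD('n) \<ge> 2"
    and "open \<Omega>" and "bounded \<Omega>" and "emeasure lebesgue \<Omega> = 1"
  shows "\<exists>c1 c2 :: real. c1 > 0 \<and> c2 > 0 \<and>
    (\<forall>t f. 0 < t \<longrightarrow> t < 1 \<longrightarrow>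
       f \<in> fun_space M (weak_Lp_norm M p) \<longrightarrow> (AE x in M. 0 \<le> f x) \<longrightarrow>
       ennreal c1 * K0 M p f t \<le> K_functional M (weak_Lp_norm M p) (Lp_norm M p) f t \<and>
       K_functional M (weak_Lp_norm M p) (Lp_norm M p) f t \<le> ennreal c2 * K0 M p f t)"
proof -
  have "\<Omega> \<in> sets lebesgue" using \<open>open \<Omega>\<close> by auto
  then interpret prob_space M
    by (intro prob_spaceI)
      (simp add: M_def space_restrict_space emeasure_restrict_space \<open>emeasure lebesgue \<Omega> = 1\<close>)
  have "1 \<le> p"
    using assms(3) by (simp add: p_def conj_exponent_def)
  then show ?thesis
    using K_functional_equiv_K0[of p]
    by (intro exI[of _ "1 / 4"] exI[of _ 4]) (auto simp: fun_space_def)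
qed

end
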